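(* Let $A$ be a finite-dimensional real associative algebra with unit such that $S=\{a\in A:a^2=-1\}$ is compact and connected, let $\mathcal U\subseteq\mathbb C$ be open and invariant under complex conjugation, $V=\pi(\mathcal U\times S)$, and let $f:V\to A$ be a generalized slice-regular function of the third class with angular part $\phi\in\mathrm{Aut}(S)$. Let $a,b\in S$ be such that $\phi(a)-\phi(b)$ is invertible in $A$. Then, for every $s\in S$ and every $z\in\mathcal U$, $$f(\pi(z,s))=f(\pi(z,a))+\bigl(\phi(s)-\phi(a)\bigr)\bigl(\phi(a)-\phi(b)\bigr)^{-1}\bigl(f(\pi(z,a))-f(\pi(z,b))\bigr).$$ In particular $f$ is determined on all of $V$ by its values on the two slices $\pi(\mathcal U\times\{a\})$ and $\pi(\mathcal U\times\{b\})$.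
   Context: $S$ is a complex manifold with $T_sS=\{h\in A:sh+hs=0\}$ and complex structure $J_S(h)=sh$. $\mathbb C\otimes A$ is over $\mathbb R$. Two maps are denoted $\pi$: $\pi(x+iy,s)=x+sy$ on $\mathbb C\times S$, and $\pi(1\otimes a+i\otimes b,s)=a+sb$ on $\mathbb C\otimes A\times S$, both with values in $A$. Involutions: $\sigma(z,s)=(\bar z,-s)$ on $\mathbb C\times S$; $\tau(z\otimes a,s)=(\bar z\otimes a,-s)$ on $\mathbb C\otimes A\times S$, extended $\mathbb R$-linearly in the first component. A function $f:V\to A$ is generalized slice-regular if there is a holomorphic map $\mathfrak F:\mathcal U\times S\to\mathbb C\otimes A\times S$ with $f\circ\pi=\pi\circ\mathfrak F$ and $\mathfrak F\circ\sigma=\tau\circ\mathfrak F$. It is of the third class with angular part $\phi$ if $\mathfrak F$ can be taken of the form $\mathfrak F(z,s)=(F(z),\phi(s))$, with $F:\mathcal U\to\mathbb C\otimes A$ holomorphic and $\phi\in\mathrm{Aut}(S)$ a holomorphic automorphism of $(S,J_S)$. *)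

theory Defs
  imports "HOL-Analysis.Analysis"
begin

text \<open>
  A finite-dimensional real associative unital algebra is a type of sort
  \<^verbatim>\<open>{real_algebra_1, euclidean_space}\<close>.  The inner product is an arbitrary auxiliary one, with
  no compatibility with the multiplication: every finite-dimensional real algebra carries one, and
  it only serves to provide the canonical topology of a finite-dimensional real vector space.
\<close>

definition imag_units :: "'a::{real_algebra_1,euclidean_space} set"  (\<open>\<S>\<close>)
  where "\<S> = {a. a\<^sup>2 = - 1}"


section \<open>Complex manifolds embedded in real vector spaces, and holomorphic maps\<close>

text \<open>
  A complex manifold embedded in a normed space is given by its point set, its tangent spaces
  (as subspaces of the ambient space) and its complex structure.  A map is holomorphic if it is
  differentiable with complex linear differential at each point; differentiability of
  a map on an embedded submanifold means differentiability within the submanifold.  The ambient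
  derivative \<^verbatim>\<open>D\<close> is determined only on tangent vectors, and is used only there.  As for
  \<^verbatim>\<open>holomorphic_on\<close>, smoothness is not demanded since it follows.
\<close>

record 'm cmanifold =
  points :: "'m set"
  tangent :: "'m \<Rightarrow> 'm set"
  cstruct :: "'m \<Rightarrow> 'm \<Rightarrow> 'm"

definition holomorphic_map ::
    "'m::real_normed_vector cmanifold \<Rightarrow> 'n::real_normed_vector cmanifold \<Rightarrow> ('m \<Rightarrow> 'n) \<Rightarrow> bool"
  where "holomorphic_map M N f \<longleftrightarrow>
    f ` points M \<subseteq> points N \<and>
    (\<forall>p\<in>points M. \<exists>D. (f has_derivative D) (at p within points M) \<and>
      (\<forall>h\<in>tangent M p. D h \<in> tangent N (f p) \<and>
        D (cstruct M p h) = cstruct N (f p) (D h)))"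

definition prod_manifold :: "'m cmanifold \<Rightarrow> 'n cmanifold \<Rightarrow> ('m \<times> 'n) cmanifold"
  where "prod_manifold M N =
    \<lparr>points = points M \<times> points N,
     tangent = (\<lambda>(p, q). tangent M p \<times> tangent N q),
     cstruct = (\<lambda>(p, q) (h, k). (cstruct M p h, cstruct N q k))\<rparr>"

definition plane_manifold :: "complex set \<Rightarrow> complex cmanifold"
  where "plane_manifold U = \<lparr>points = U, tangent = (\<lambda>_. UNIV), cstruct = (\<lambda>_ w. \<i> * w)\<rparr>"

definition units_manifold :: "'a::{real_algebra_1,euclidean_space} cmanifold"
  where "units_manifold =
    \<lparr>points = \<S>, tangent = (\<lambda>s. {h. s * h + h * s = 0}), cstruct = (\<lambda>s h. s * h)\<rparr>"

definition Aut_units :: "('a::{real_algebra_1,euclidean_space} \<Rightarrow> 'a) set"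
  where "Aut_units = {\<phi>. bij_betw \<phi> \<S> \<S> \<and>
    holomorphic_map units_manifold units_manifold \<phi> \<and>
    holomorphic_map units_manifold units_manifold (inv_into \<S> \<phi>)}"


section \<open>The complexification\<close>

text \<open>
  The tensor product of \<^verbatim>\<open>\<complex>\<close> and \<^verbatim>\<open>A\<close> over the reals is modelled by pairs:
  \<^verbatim>\<open>(a, b)\<close> stands for \<^verbatim>\<open>1 \<otimes> a + \<i> \<otimes> b\<close>.
\<close>

type_synonym 'a complexified = "'a \<times> 'a"

definition ctensor :: "complex \<Rightarrow> 'a::real_vector \<Rightarrow> 'a complexified"  (infixl \<open>\<otimes>\<^sub>c\<close> 75)
  where "z \<otimes>\<^sub>c a = (Re z *\<^sub>R a, Im z *\<^sub>R a)"

lemma ctensor_decompose: "(a, b) = 1 \<otimes>\<^sub>c a + \<i> \<otimes>\<^sub>c b"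
  by (simp add: ctensor_def)

lemma bilinear_ctensor: "bilinear (\<otimes>\<^sub>c)"
  by (auto simp: bilinear_def ctensor_def intro!: linearI simp: algebra_simps)

lemma ctensor_universal:
  fixes h :: "complex \<Rightarrow> 'a::real_vector \<Rightarrow> 'b::real_vector"
  assumes "bilinear h"
  shows "\<exists>!L. linear L \<and> (\<forall>z a. L (z \<otimes>\<^sub>c a) = h z a)"
proof (rule ex1I)
  let ?L = "\<lambda>u. h 1 (fst u) + h \<i> (snd u)"
  have lin: "linear (h z)" for z using assms by (simp add: bilinear_def)
  have "linear ?L"
    by (rule linearI) (simp_all add: linear_add[OF lin] linear_scale[OF lin] algebra_simps)
  moreover have "?L (z \<otimes>\<^sub>c a) = h z a" for z a
  proof -
    have l: "linear (\<lambda>w. h w a)" using assms by (simp add: bilinear_def)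
    have "z = Re z *\<^sub>R 1 + Im z *\<^sub>R \<i>" by (simp add: complex_eq_iff)
    then have "h z a = h (Re z *\<^sub>R 1 + Im z *\<^sub>R \<i>) a" by simp
    also have "\<dots> = Re z *\<^sub>R h 1 a + Im z *\<^sub>R h \<i> a"
      using linear_add[OF l] linear_scale[OF l] by metis
    finally show ?thesis by (simp add: ctensor_def linear_scale[OF lin])
  qed
  ultimately show "linear ?L \<and> (\<forall>z a. ?L (z \<otimes>\<^sub>c a) = h z a)" by blast
next
  fix L assume L: "linear L \<and> (\<forall>z a. L (z \<otimes>\<^sub>c a) = h z a)"
  show "L = (\<lambda>u. h 1 (fst u) + h \<i> (snd u))"
  proof
    fix u
    have "L u = L (1 \<otimes>\<^sub>c fst u + \<i> \<otimes>\<^sub>c snd u)"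
      by (simp flip: ctensor_decompose)
    also have "\<dots> = h 1 (fst u) + h \<i> (snd u)"
      using L linear_add by metis
    finally show "L u = h 1 (fst u) + h \<i> (snd u)" .
  qed
qed

text \<open>The complex structure is multiplication by \<^verbatim>\<open>\<i>\<close> on the complex tensor factor.\<close>

definition complexified_manifold :: "'a::real_vector complexified cmanifold"
  where "complexified_manifold =
    \<lparr>points = UNIV, tangent = (\<lambda>_. UNIV), cstruct = (\<lambda>_ (a, b). (- b, a))\<rparr>"

lemma cstruct_complexified: "cstruct complexified_manifold p (z \<otimes>\<^sub>c a) = (\<i> * z) \<otimes>\<^sub>c a"
  by (simp add: complexified_manifold_def ctensor_def)


section \<open>Generalized slice-regular functions\<close>

definition slice_pi :: "complex \<times> 'a::{real_algebra_1,euclidean_space} \<Rightarrow> 'a"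
  where "slice_pi = (\<lambda>(z, s). of_real (Re z) + s * of_real (Im z))"

definition tensor_pi :: "'a complexified \<times> 'a::{real_algebra_1,euclidean_space} \<Rightarrow> 'a"
  where "tensor_pi = (\<lambda>((a, b), s). a + s * b)"

definition slice_sigma :: "complex \<times> 'a::{real_algebra_1,euclidean_space} \<Rightarrow> complex \<times> 'a"
  where "slice_sigma = (\<lambda>(z, s). (cnj z, - s))"

definition tensor_tau ::
    "'a complexified \<times> 'a::{real_algebra_1,euclidean_space} \<Rightarrow> 'a complexified \<times> 'a"
  where "tensor_tau = (\<lambda>((a, b), s). ((a, - b), - s))"

lemma tensor_tau_ctensor: "tensor_tau (z \<otimes>\<^sub>c a, s) = (cnj z \<otimes>\<^sub>c a, - s)"
  by (simp add: tensor_tau_def ctensor_def)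

definition slice_domain :: "complex set \<Rightarrow> 'a::{real_algebra_1,euclidean_space} set"
  where "slice_domain U = slice_pi ` (U \<times> \<S>)"

text \<open>
  Functions on \<^verbatim>\<open>V = slice_domain U\<close> are represented by total functions, of which only the values
  on \<^verbatim>\<open>V\<close> are ever referred to.
\<close>

definition slice_lift ::
    "complex set \<Rightarrow> ('a::{real_algebra_1,euclidean_space} \<Rightarrow> 'a)
      \<Rightarrow> (complex \<times> 'a \<Rightarrow> 'a complexified \<times> 'a) \<Rightarrow> bool"
  where "slice_lift U f FF \<longleftrightarrow>
    holomorphic_map (prod_manifold (plane_manifold U) units_manifold)
      (prod_manifold complexified_manifold units_manifold) FF \<and>
    (\<forall>p\<in>U \<times> \<S>. f (slice_pi p) = tensor_pi (FF p)) \<and>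
    (\<forall>p\<in>U \<times> \<S>. FF (slice_sigma p) = tensor_tau (FF p))"

definition generalized_slice_regular ::
    "complex set \<Rightarrow> ('a::{real_algebra_1,euclidean_space} \<Rightarrow> 'a) \<Rightarrow> bool"
  where "generalized_slice_regular U f \<longleftrightarrow> (\<exists>FF. slice_lift U f FF)"

definition third_class ::
    "complex set \<Rightarrow> ('a::{real_algebra_1,euclidean_space} \<Rightarrow> 'a) \<Rightarrow> ('a \<Rightarrow> 'a) \<Rightarrow> bool"
  where "third_class U f \<phi> \<longleftrightarrow> \<phi> \<in> Aut_units \<and>
    (\<exists>F. holomorphic_map (plane_manifold U) complexified_manifold F \<and>
      slice_lift U f (\<lambda>(z, s). (F z, \<phi> s)))"


section \<open>Invertibility in a (non-commutative) algebra\<close>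

definition alg_invertible :: "'a::monoid_mult \<Rightarrow> bool"
  where "alg_invertible x \<longleftrightarrow> (\<exists>y. x * y = 1 \<and> y * x = 1)"

definition alg_inverse :: "'a::monoid_mult \<Rightarrow> 'a"
  where "alg_inverse x = (THE y. x * y = 1 \<and> y * x = 1)"

lemma alg_inverse_eqI:
  assumes "x * y = 1" "y * x = 1"
  shows "alg_inverse x = y"
  unfolding alg_inverse_def
proof (rule the_equality)
  fix w assume w: "x * w = 1 \<and> w * x = 1"
  have "w = y * x * w" using assms by simp
  also have "\<dots> = y" using w by (simp add: mult.assoc)
  finally show "w = y" .
qed (use assms in simp)

lemma alg_inverse:
  assumes "alg_invertible x"
  shows "x * alg_inverse x = 1" "alg_inverse x * x = 1"
  using assms alg_inverse_eqI unfolding alg_invertible_def by metis+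

end

theory Submission
  imports Defs
begin

text \<open>For fixed z, f is affine in \<phi>(s): writing the first component of the lift as F = G
  + iH, compatibility with the two projections gives f(\<pi>(z,s)) = G(z) + \<phi>(s) H(z)
  (\<open>third_class_stem\<close>). Two values with \<phi>(a) - \<phi>(b) invertible determine such
  a function, and \<open>third_class_representation\<close> is the resulting noncommutative
  two-point interpolation.\<close>

lemma third_class_stem:
  assumes "third_class U f \<phi>"
  obtains G H where "\<And>z s. z \<in> U \<Longrightarrow> s \<in> \<S> \<Longrightarrow> f (slice_pi (z, s)) = G z + \<phi> s * H z"
proof -
  obtain F where "slice_lift U f (\<lambda>(z, s). (F z, \<phi> s))"
    using assms by (auto simp: third_class_def)
  then have "f (slice_pi (z, s)) = fst (F z) + \<phi> s * snd (F z)" if "z \<in> U" "s \<in> \<S>" for z s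
    using that by (auto simp: slice_lift_def tensor_pi_def split: prod.splits)
  then show ?thesis by (rule that)
qed

text \<open>The slope H(z) is a right factor, so it is isolated by inverting on the left. Besides
  \<open>f\<close>, the formula is applied to a competitor \<open>g\<close> with the same
  \<open>\<phi>\<close>, which yields uniqueness.\<close>

lemma third_class_representation:
  fixes f \<phi> :: "'a::{real_algebra_1,euclidean_space} \<Rightarrow> 'a"
  assumes "third_class U f \<phi>" "a \<in> \<S>" "b \<in> \<S>" "alg_invertible (\<phi> a - \<phi> b)" "s \<in> \<S>" "z \<in> U"
  shows "f (slice_pi (z, s)) = f (slice_pi (z, a)) +
    (\<phi> s - \<phi> a) * alg_inverse (\<phi> a - \<phi> b) * (f (slice_pi (z, a)) - f (slice_pi (z, b)))"
proof -
  obtain G H where f: "\<And>z s. z \<in> U \<Longrightarrow> s \<in> \<S> \<Longrightarrow> f (slice_pi (z, s)) = G z + \<phi> s * H z"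
    using third_class_stem[OF assms(1)] by metis
  \<comment> \<open>The term \<open>G z\<close> is the same at both units and cancels.\<close>
  have "f (slice_pi (z, a)) - f (slice_pi (z, b)) = (\<phi> a - \<phi> b) * H z"
    using assms by (simp add: f algebra_simps)
  then have "alg_inverse (\<phi> a - \<phi> b) * (f (slice_pi (z, a)) - f (slice_pi (z, b))) = H z"
    using alg_inverse(2)[OF assms(4)] by (metis mult.assoc mult_1_left)
  then show ?thesis
    \<comment> \<open>Reassociating first lets the previous equation replace the inverse and the
      difference by \<open>H z\<close>; expanding \<open>f\<close> earlier would destroy that
      pattern.\<close>
    using assms by (simp add: mult.assoc) (simp add: f algebra_simps)
qed

theorem theorem6p7:
  fixes U :: "complex set"
    and f \<phi> :: "'a::{real_algebra_1,euclidean_space} \<Rightarrow> 'a"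
    and a b :: 'a
  assumes "compact (\<S> :: 'a set)" and "connected (\<S> :: 'a set)"
    and "open U" and "cnj ` U = U"
    and "generalized_slice_regular U f" and "third_class U f \<phi>"
    and "a \<in> \<S>" and "b \<in> \<S>"
    and "alg_invertible (\<phi> a - \<phi> b)"
  shows "(\<forall>s\<in>\<S>. \<forall>z\<in>U.
            f (slice_pi (z, s)) = f (slice_pi (z, a)) +
              (\<phi> s - \<phi> a) * alg_inverse (\<phi> a - \<phi> b) * (f (slice_pi (z, a)) - f (slice_pi (z, b))))
       \<and> (\<forall>g. generalized_slice_regular U g \<and> third_class U g \<phi> \<and>
              (\<forall>x \<in> slice_pi ` (U \<times> {a}) \<union> slice_pi ` (U \<times> {b}). g x = f x) \<longrightarrow>
            (\<forall>x \<in> slice_domain U. g x = f x))"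
proof (intro conjI allI impI ballI)
  fix s :: 'a and z assume "s \<in> \<S>" "z \<in> U"
  then show "f (slice_pi (z, s)) = f (slice_pi (z, a)) +
      (\<phi> s - \<phi> a) * alg_inverse (\<phi> a - \<phi> b) * (f (slice_pi (z, a)) - f (slice_pi (z, b)))"
    using third_class_representation assms by blast
next
  fix g :: "'a \<Rightarrow> 'a" and x :: 'a
  assume g: "generalized_slice_regular U g \<and> third_class U g \<phi> \<and>
      (\<forall>x \<in> slice_pi ` (U \<times> {a}) \<union> slice_pi ` (U \<times> {b}). g x = f x)"
    and "x \<in> slice_domain U"
  then obtain z s where x: "x = slice_pi (z, s)" "z \<in> U" "s \<in> \<S>"
    by (auto simp: slice_domain_def)
  have "g (slice_pi (z, a)) = f (slice_pi (z, a))" "g (slice_pi (z, b)) = f (slice_pi (z, b))"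
    using g x by blast+
  moreover have "third_class U g \<phi>"
    using g by blast
  \<comment> \<open>The coefficients in the formula depend only on \<open>\<phi>\<close>, so equal
    values at (z,a) and (z,b) give equal right-hand sides for \<open>g\<close> and
    \<open>f\<close>.\<close>
  ultimately show "g x = f x"
    unfolding x(1) using third_class_representation[OF _ assms(7-9) x(3,2)] assms(6) by metis
qed

end
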